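(* Let $\ell \le m \le n$ be positive integers. A tensor $\mathbf{X} \in \mathbb{R}^{\ell \times m \times n}$ is orthogonal if and only if the induced bilinear form $\omega_{\mathbf{X}}\colon\mathbb{R}^\ell\times\mathbb{R}^m\to\mathbb{R}^n$ is a solution to the Hurwitz problem, that is, $\omega=\omega_{\mathbf{X}}$ satisfies \[ \sum_{k = 1}^n \omega_k(u,v)^2 = \left( \sum_{i = 1}^\ell u_i^2 \right) \left( \sum_{j=1}^m v_j^2 \right)\quad\text{for all } u\in\mathbb{R}^\ell,\ v\in\mathbb{R}^m . \] Correspondingly, it holds that \[ \operatorname{App}_3(\mathbb{R};\ell,m,n) = \frac{1}{\sqrt{\ell m}} \] if and only if $[\ell,m,n]$ is an admissible triple for the Hurwitz problem.
   Context: A triple $[\ell,m,n]$ of positive integers is called admissible for the Hurwitz problem (over $\mathbb{R}$) if there exists a bilinear map $\omega=(\omega_1,\dots,\omega_n)\colon\mathbb{R}^\ell\times\mathbb{R}^m\to\mathbb{R}^n$ with $\sum_{k=1}^n\omega_k(u,v)^2=(\sum_{i=1}^\ell u_i^2)(\sum_{j=1}^m v_j^2)$ for all $u\in\mathbb{R}^\ell$, $v\in\mathbb{R}^m$; such an $\omega$ is called a solution to the Hurwitz problem. For $\mathbf{X}\in\mathbb{R}^{\ell\times m\times n}$ the induced bilinear form is $\omega_{\mathbf{X}}(u,v)=\mathbf{X}\times_1u\times_2v\in\mathbb{R}^n$, i.e. the vector with $k$-th entry $\sum_{i=1}^\ell\sum_{j=1}^m u_i v_j\,\mathbf{X}(i,j,k)$.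 Orthogonal tensors: a vector is orthogonal if its Euclidean norm is one; for $n_1\le\dots\le n_d$, $d\ge2$, a real tensor $\mathbf{X}\in\mathbb{R}^{n_1\times\dots\times n_d}$ is orthogonal if for every unit vector $u\in\mathbb{R}^{n_1}$ the order-$(d-1)$ tensor $\mathbf{X}\times_1u$ with entries $\sum_{i}u(i)\mathbf{X}(i,i_2,\dots,i_d)$ is orthogonal. The Frobenius norm $\|\mathbf{X}\|_F$ is the Euclidean norm of the array of entries, with inner product $\langle\mathbf{X},\mathbf{Y}\rangle_F=\sum\mathbf{X}(i,j,k)\mathbf{Y}(i,j,k)$; the spectral norm is $\|\mathbf{X}\|_2=\max\{|\langle\mathbf{X},u\otimes v\otimes w\rangle_F|: \|u\|=\|v\|=\|w\|=1\}$, where $u\otimes v\otimes w$ has entries $u_iv_jw_k$; and $\operatorname{App}_3(\mathbb{R};\ell,m,n)=\min_{0\ne\mathbf{X}\in\mathbb{R}^{\ell\times m\times n}}\|\mathbf{X}\|_2/\|\mathbf{X}\|_F$. *)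

theory Defs
  imports "HOL-Analysis.Analysis"
begin

(* A tensor of size l x m x n is an element of real^'n^'m^'l with CARD('l) = l, CARD('m) = m,
   CARD('n) = n; its (i,j,k) entry is X $ i $ j $ k.  The Frobenius norm and inner product are
   the library's norm and \<bullet> on this iterated vector type, see norm_tensor3 and inner_tensor3. *)

type_synonym ('l, 'm, 'n) tensor3 = "real ^ 'n ^ 'm ^ 'l"

lemma inner_tensor3:
  fixes X Y :: "('l::finite, 'm::finite, 'n::finite) tensor3"
  shows "X \<bullet> Y = (\<Sum>i\<in>UNIV. \<Sum>j\<in>UNIV. \<Sum>k\<in>UNIV. X $ i $ j $ k * Y $ i $ j $ k)"
  by (simp add: inner_vec_def)

lemma norm_tensor3:
  fixes X :: "('l::finite, 'm::finite, 'n::finite) tensor3"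
  shows "norm X = sqrt (\<Sum>i\<in>UNIV. \<Sum>j\<in>UNIV. \<Sum>k\<in>UNIV. (X $ i $ j $ k)\<^sup>2)"
  by (simp add: norm_eq_sqrt_inner inner_tensor3 power2_eq_square)

text \<open>The contraction of the first mode, for tensors of any order: an order-\<open>d\<close> tensor is
  a vector of order-\<open>(d-1)\<close> tensors.\<close>

definition contract_first :: "'a::real_vector ^ 'k \<Rightarrow> real ^ 'k::finite \<Rightarrow> 'a" where
  "contract_first X u = (\<Sum>i\<in>UNIV. (u $ i) *\<^sub>R (X $ i))"

text \<open>Orthogonality is recursive in the order.  The recursion changes the type, so it is written
  out for orders 1, 2, 3.  It is meant for dimensions in non-decreasing order, the first index
  having the smallest range; this is left to the statements using it.\<close>

definition orthogonal_tensor1 :: "real ^ 'n::finite \<Rightarrow> bool" where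
  "orthogonal_tensor1 x \<longleftrightarrow> norm x = 1"

definition orthogonal_tensor2 :: "real ^ 'n::finite ^ 'm::finite \<Rightarrow> bool" where
  "orthogonal_tensor2 A \<longleftrightarrow> (\<forall>v. norm v = 1 \<longrightarrow> orthogonal_tensor1 (contract_first A v))"

definition orthogonal_tensor3 :: "('l::finite, 'm::finite, 'n::finite) tensor3 \<Rightarrow> bool" where
  "orthogonal_tensor3 X \<longleftrightarrow> (\<forall>u. norm u = 1 \<longrightarrow> orthogonal_tensor2 (contract_first X u))"

definition induced_form ::
  "('l::finite, 'm::finite, 'n::finite) tensor3 \<Rightarrow> real ^ 'l \<Rightarrow> real ^ 'm \<Rightarrow> real ^ 'n" where
  "induced_form X u v = (\<chi> k. \<Sum>i\<in>UNIV. \<Sum>j\<in>UNIV. u $ i * v $ j * X $ i $ j $ k)"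

definition hurwitz_solution ::
  "(real ^ 'l::finite \<Rightarrow> real ^ 'm::finite \<Rightarrow> real ^ 'n::finite) \<Rightarrow> bool" where
  "hurwitz_solution \<omega> \<longleftrightarrow> bilinear \<omega> \<and>
     (\<forall>u v. (\<Sum>k\<in>UNIV. (\<omega> u v $ k)\<^sup>2) = (\<Sum>i\<in>UNIV. (u $ i)\<^sup>2) * (\<Sum>j\<in>UNIV. (v $ j)\<^sup>2))"

definition hurwitz_admissible ::
  "'l::finite itself \<Rightarrow> 'm::finite itself \<Rightarrow> 'n::finite itself \<Rightarrow> bool" where
  "hurwitz_admissible _ _ _ \<longleftrightarrow>
     (\<exists>\<omega> :: real ^ 'l \<Rightarrow> real ^ 'm \<Rightarrow> real ^ 'n. hurwitz_solution \<omega>)"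

definition rank_one ::
  "real ^ 'l::finite \<Rightarrow> real ^ 'm::finite \<Rightarrow> real ^ 'n::finite \<Rightarrow> ('l, 'm, 'n) tensor3" where
  "rank_one u v w = (\<chi> i j k. u $ i * v $ j * w $ k)"

text \<open>The supremum and the infimum below are a maximum and a minimum:
  see \<open>spectral_norm_attained\<close> and \<open>App3_attained\<close>.\<close>

definition spectral_norm :: "('l::finite, 'm::finite, 'n::finite) tensor3 \<Rightarrow> real" where
  "spectral_norm X =
     Sup {\<bar>X \<bullet> rank_one u v w\<bar> | u v w. norm u = 1 \<and> norm v = 1 \<and> norm w = 1}"

definition App3 :: "'l::finite itself \<Rightarrow> 'm::finite itself \<Rightarrow> 'n::finite itself \<Rightarrow> real" where
  "App3 _ _ _ = Inf {spectral_norm X / norm X | X :: ('l, 'm, 'n) tensor3. X \<noteq> 0}"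

lemma spectral_norm_max:
  fixes X :: "('l::finite, 'm::finite, 'n::finite) tensor3"
  shows "\<exists>u v w. norm u = 1 \<and> norm v = 1 \<and> norm w = 1 \<and> spectral_norm X = \<bar>X \<bullet> rank_one u v w\<bar> \<and>
    (\<forall>u v w. norm u = 1 \<longrightarrow> norm v = 1 \<longrightarrow> norm w = 1 \<longrightarrow> \<bar>X \<bullet> rank_one u v w\<bar> \<le> spectral_norm X)"
proof -
  let ?K = "sphere (0::real^'l) 1 \<times> sphere (0::real^'m) 1 \<times> sphere (0::real^'n) 1"
  let ?f = "\<lambda>(u,v,w). \<bar>X \<bullet> rank_one u v w\<bar>"
  have "compact ?K" by (intro compact_Times compact_sphere)
  moreover have "(axis undefined 1, axis undefined 1, axis undefined 1) \<in> ?K" by simp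
  then have "?K \<noteq> {}" by (rule ex_in_conv[THEN iffD1, OF exI])
  moreover have "continuous_on ?K ?f"
    unfolding inner_tensor3 rank_one_def case_prod_unfold vec_lambda_beta
    by (intro continuous_intros)
  ultimately obtain z where z: "z \<in> ?K" "\<And>y. y \<in> ?K \<Longrightarrow> ?f y \<le> ?f z"
    using continuous_attains_sup[of ?K ?f] by blast
  obtain u v w where [simp]: "z = (u, v, w)" by (cases z)
  have n: "norm u = 1" "norm v = 1" "norm w = 1" using z(1) by auto
  have le: "\<bar>X \<bullet> rank_one u' v' w'\<bar> \<le> \<bar>X \<bullet> rank_one u v w\<bar>"
    if "norm u' = 1" "norm v' = 1" "norm w' = 1" for u' v' w'
    using z(2)[of "(u', v', w')"] that by simp
  have "spectral_norm X = \<bar>X \<bullet> rank_one u v w\<bar>"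
    unfolding spectral_norm_def
  proof (rule cSup_eq_maximum)
    show "\<bar>X \<bullet> rank_one u v w\<bar> \<in>
        {\<bar>X \<bullet> rank_one u v w\<bar> | u v w. norm u = 1 \<and> norm v = 1 \<and> norm w = 1}"
      using n by blast
  qed (auto dest: le)
  with n le show ?thesis by (intro exI[of _ u] exI[of _ v] exI[of _ w]) simp
qed

lemma spectral_norm_attained:
  "\<exists>u v w. norm u = 1 \<and> norm v = 1 \<and> norm w = 1 \<and> spectral_norm X = \<bar>X \<bullet> rank_one u v w\<bar>"
  using spectral_norm_max[of X] by blast

lemma spectral_norm_upper:
  "norm u = 1 \<Longrightarrow> norm v = 1 \<Longrightarrow> norm w = 1 \<Longrightarrow> \<bar>X \<bullet> rank_one u v w\<bar> \<le> spectral_norm X"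
  using spectral_norm_max[of X] by blast

lemma norm_rank_one: "norm (rank_one u v w) = norm u * norm v * norm w"
proof -
  have "rank_one u v w \<bullet> rank_one u v w =
      (\<Sum>i\<in>UNIV. \<Sum>j\<in>UNIV. \<Sum>k\<in>UNIV. (u $ i * u $ i) * ((v $ j * v $ j) * (w $ k * w $ k)))"
    by (simp add: inner_tensor3 rank_one_def mult_ac)
  also have "\<dots> = (u \<bullet> u) * ((v \<bullet> v) * (w \<bullet> w))"
    unfolding sum_distrib_left[symmetric] sum_distrib_right[symmetric] inner_vec_def by simp
  finally show ?thesis by (simp add: norm_eq_sqrt_inner real_sqrt_mult)
qed

lemma spectral_norm_lipschitz: "spectral_norm X \<le> spectral_norm Y + norm (X - Y)"
proof -
  obtain u v w where n: "norm u = 1" "norm v = 1" "norm w = 1"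
    and e: "spectral_norm X = \<bar>X \<bullet> rank_one u v w\<bar>"
    using spectral_norm_attained by blast
  have "\<bar>(X - Y) \<bullet> rank_one u v w\<bar> \<le> norm (X - Y)"
    using Cauchy_Schwarz_ineq2[of "X - Y" "rank_one u v w"] n by (simp add: norm_rank_one)
  then show ?thesis
    using spectral_norm_upper[OF n, of Y] e by (simp add: inner_diff_left)
qed

lemma spectral_norm_scaleR_pos:
  assumes "c > 0" shows "spectral_norm (c *\<^sub>R X) = c * spectral_norm X"
proof (rule antisym)
  obtain u v w where n: "norm u = 1" "norm v = 1" "norm w = 1"
    and e: "spectral_norm (c *\<^sub>R X) = \<bar>(c *\<^sub>R X) \<bullet> rank_one u v w\<bar>"
    using spectral_norm_attained by blast
  have "spectral_norm (c *\<^sub>R X) = c * \<bar>X \<bullet> rank_one u v w\<bar>"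
    using e assms by (simp add: abs_mult)
  then show "spectral_norm (c *\<^sub>R X) \<le> c * spectral_norm X"
    using spectral_norm_upper[OF n, of X] assms by simp
next
  obtain u v w where n: "norm u = 1" "norm v = 1" "norm w = 1"
    and e: "spectral_norm X = \<bar>X \<bullet> rank_one u v w\<bar>"
    using spectral_norm_attained by blast
  show "c * spectral_norm X \<le> spectral_norm (c *\<^sub>R X)"
    using spectral_norm_upper[OF n, of "c *\<^sub>R X"] e assms by (simp add: abs_mult)
qed

lemma App3_attained:
  "\<exists>X :: ('l::finite, 'm::finite, 'n::finite) tensor3. X \<noteq> 0 \<and>
     App3 TYPE('l) TYPE('m) TYPE('n) = spectral_norm X / norm X \<and>
     (\<forall>Y :: ('l, 'm, 'n) tensor3. Y \<noteq> 0 \<longrightarrow> spectral_norm X / norm X \<le> spectral_norm Y / norm Y)"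
proof -
  let ?S = "sphere (0 :: ('l, 'm, 'n) tensor3) 1"
  have "continuous_on ?S spectral_norm"
  proof (rule continuous_onI)
    fix X Y :: "('l, 'm, 'n) tensor3" and e :: real assume "e > 0"
    have "dist (spectral_norm Y) (spectral_norm X) \<le> dist Y X" for X Y :: "('l, 'm, 'n) tensor3"
      using spectral_norm_lipschitz[of X Y] spectral_norm_lipschitz[of Y X]
      by (simp add: dist_real_def dist_norm norm_minus_commute)
    then show "\<exists>d>0. \<forall>X'\<in>?S. dist X' X < d \<longrightarrow> dist (spectral_norm X') (spectral_norm X) \<le> e"
      using \<open>e > 0\<close> by (meson less_imp_le order_trans)
  qed
  moreover have "axis undefined (axis undefined (axis undefined 1)) \<in> ?S" by simp
  then have "?S \<noteq> {}" by (rule ex_in_conv[THEN iffD1, OF exI])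
  ultimately obtain X where X: "X \<in> ?S" "\<And>Y. Y \<in> ?S \<Longrightarrow> spectral_norm X \<le> spectral_norm Y"
    using continuous_attains_inf[of ?S spectral_norm] compact_sphere by blast
  have nX: "norm X = 1" "X \<noteq> 0" using X(1) by auto
  have le: "spectral_norm X / norm X \<le> spectral_norm Y / norm Y"
    if "Y \<noteq> 0" for Y :: "('l, 'm, 'n) tensor3"
    using X(2)[of "(1 / norm Y) *\<^sub>R Y"] that nX spectral_norm_scaleR_pos[of "1 / norm Y" Y]
    by simp
  have "App3 TYPE('l) TYPE('m) TYPE('n) = spectral_norm X / norm X"
    unfolding App3_def
    by (rule cInf_eq_minimum) (use nX(2) le in auto)
  then show ?thesis using nX le by blast
qed

end

theory Submission
  imports Defs
begin

text \<open>Contracting the first two modes of a tensor \<open>X\<close> with \<open>u\<close> and \<open>v\<close> gives the vector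
  \<open>\<omega>(u, v)\<close> of the induced form, and a bilinear map solves the Hurwitz problem iff it
  multiplies norms, \<open>\<parallel>\<omega>(u, v)\<parallel> = \<parallel>u\<parallel> \<parallel>v\<parallel>\<close>. Orthogonality of \<open>X\<close> is this condition on unit
  vectors, so the first equivalence is homogeneity.

  For the second one, \<open>\<langle>X, u \<otimes> v \<otimes> w\<rangle> = \<langle>\<omega>(u, v), w\<rangle>\<close> shows that the spectral norm \<open>\<sigma>\<close> of \<open>X\<close> is
  the least constant with \<open>\<parallel>\<omega>(u, v)\<parallel> \<le> \<sigma> \<parallel>u\<parallel> \<parallel>v\<parallel>\<close>, whereas
  \<open>\<parallel>X\<parallel>\<^sup>2 = (\<Sum>i j. \<parallel>\<omega>(e\<^sub>i, e\<^sub>j)\<parallel>\<^sup>2)\<close>. Bounding each of the \<open>\<ell> m\<close> summands by \<open>\<sigma>\<^sup>2\<close> gives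
  \<open>\<parallel>X\<parallel> \<le> \<surd>(\<ell> m) \<sigma>\<close>, that is, \<open>1 / \<surd>(\<ell> m)\<close> is always a lower bound for the approximation
  ratio. The tensor of a solution to the Hurwitz problem has \<open>\<sigma> \<le> 1\<close> and all summands equal
  to \<open>1\<close>, so it attains the bound.

  Conversely, suppose that a tensor attains the bound. Then each summand equals \<open>\<sigma>\<^sup>2\<close>. A linear map
  bounded by \<open>\<sigma>\<close> that attains this bound on an orthonormal basis attains it everywhere
  (\<open>norm_linear_eq_if_extremal_on_Basis\<close>). This fact, used first in the second argument of \<open>\<omega>\<close>
  and then in the first, gives \<open>\<parallel>\<omega>(u, v)\<parallel> = \<sigma> \<parallel>u\<parallel> \<parallel>v\<parallel>\<close> for all \<open>u\<close> and \<open>v\<close>. Hence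
  \<open>\<omega> / \<sigma>\<close> solves the Hurwitz problem.\<close>

section \<open>An extremal principle for linear maps\<close>

text \<open>The quadratic form \<open>c\<^sup>2 \<parallel>x\<parallel>\<^sup>2 - \<parallel>f x\<parallel>\<^sup>2\<close> is positive semidefinite, so each of its zeros is
  orthogonal, with respect to the associated bilinear form, to every vector. If the whole basis
  consists of zeros, then the bilinear form vanishes.\<close>

lemma norm_linear_eq_if_extremal_on_Basis:
  fixes f :: "'a::euclidean_space \<Rightarrow> 'b::real_inner"
  assumes lin: "linear f"
    and le: "\<And>x. norm (f x) \<le> c * norm x"
    and ext: "\<And>b. b \<in> Basis \<Longrightarrow> norm (f b) = c"
  shows "norm (f x) = c * norm x"
proof -
  interpret linear f by fact
  have c: "c \<ge> 0"
    using ext[OF SOME_Basis] norm_ge_zero by metis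
  have sq_le: "f y \<bullet> f y \<le> c\<^sup>2 * (y \<bullet> y)" for y
    using power_mono[OF le[of y], of 2] by (simp add: power_mult_distrib power2_norm_eq_inner)
  have polar: "f b \<bullet> f y = c\<^sup>2 * (b \<bullet> y)" if b: "b \<in> Basis" for b y
  proof -
    define p where "p = f b \<bullet> f y - c\<^sup>2 * (b \<bullet> y)"
    define q where "q = c\<^sup>2 * (y \<bullet> y) - f y \<bullet> f y"
    have q: "q \<ge> 0" using sq_le[of y] by (simp add: q_def)
    have bb: "f b \<bullet> f b = c\<^sup>2 * (b \<bullet> b)"
      using ext[OF b] b by (metis inner_same_Basis mult.right_neutral power2_norm_eq_inner)
    have "2 * t * p \<le> t\<^sup>2 * q" for t
      using sq_le[of "b + t *\<^sub>R y"] bb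
      by (simp add: p_def q_def add scale inner_add_left inner_add_right inner_commute
          algebra_simps power2_eq_square)
    \<comment> \<open>at this \<open>t\<close> the linear term dominates the quadratic one; the denominator is
      \<open>q + 1\<close> because \<open>q\<close> itself may be zero\<close>
    from this[of "p / (q + 1)"] have "2 * p\<^sup>2 / (q + 1) \<le> p\<^sup>2 * q / (q + 1)\<^sup>2"
      by (simp add: power2_eq_square)
    then have "2 * p\<^sup>2 * (q + 1) \<le> p\<^sup>2 * q"
      using q by (simp add: divide_simps power2_eq_square split: if_splits)
    then have "p\<^sup>2 * (q + 2) \<le> 0" by (simp add: algebra_simps)
    then have "p = 0" using q by (simp add: mult_le_0_iff)
    then show ?thesis by (simp add: p_def)
  qed
  have "f x = (\<Sum>b\<in>Basis. (x \<bullet> b) *\<^sub>R f b)"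
    by (subst euclidean_representation[of x, symmetric]) (simp add: sum scale)
  then have "f x \<bullet> f x = (\<Sum>b\<in>Basis. (x \<bullet> b) * (f b \<bullet> f x))"
    by (metis (no_types, lifting) inner_scaleR_left inner_sum_left sum.cong)
  also have "\<dots> = c\<^sup>2 * (\<Sum>b\<in>Basis. (x \<bullet> b) * (x \<bullet> b))"
    unfolding sum_distrib_left
    by (rule sum.cong) (simp_all add: polar inner_commute mult_ac)
  also have "\<dots> = c\<^sup>2 * (x \<bullet> x)" by (simp add: euclidean_inner[of x x])
  finally have "(norm (f x))\<^sup>2 = (c * norm x)\<^sup>2"
    by (simp add: power2_norm_eq_inner power_mult_distrib)
  then show ?thesis using c by (simp add: power2_eq_iff_nonneg)
qed

section \<open>The induced form, orthogonality and the Hurwitz problem\<close>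

lemma sum_power2_eq_norm: "(\<Sum>i\<in>UNIV. (x $ i)\<^sup>2) = (norm x)\<^sup>2" for x :: "real ^ 'n::finite"
  unfolding power2_norm_eq_inner inner_vec_def by (simp add: power2_eq_square)

lemma hurwitz_solution_iff_norm:
  "hurwitz_solution \<omega> \<longleftrightarrow> bilinear \<omega> \<and> (\<forall>u v. norm (\<omega> u v) = norm u * norm v)"
proof -
  have "(norm (\<omega> u v))\<^sup>2 = (norm u)\<^sup>2 * (norm v)\<^sup>2 \<longleftrightarrow> norm (\<omega> u v) = norm u * norm v" for u v
    by (simp add: power_mult_distrib[symmetric])
  then show ?thesis by (simp add: hurwitz_solution_def sum_power2_eq_norm)
qed

lemma bilinear_induced_form: "bilinear (induced_form X)"
  unfolding bilinear_def induced_form_def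
  by (auto intro!: linearI
      simp: vec_eq_iff sum_distrib_left sum.distrib[symmetric] algebra_simps)

lemma contract_first_twice: "contract_first (contract_first X u) v = induced_form X u v"
  unfolding contract_first_def induced_form_def vec_eq_iff
  by (subst sum.swap) (simp add: sum_distrib_left mult_ac)

text \<open>Through this identity the spectral norm of a tensor becomes the operator norm of its induced
  form.\<close>

lemma inner_rank_one: "X \<bullet> rank_one u v w = induced_form X u v \<bullet> w"
proof -
  have "induced_form X u v \<bullet> w =
      (\<Sum>k\<in>UNIV. \<Sum>i\<in>UNIV. \<Sum>j\<in>UNIV. X $ i $ j $ k * (u $ i * v $ j * w $ k))"
    by (simp add: induced_form_def inner_vec_def sum_distrib_left mult_ac)
  also have "\<dots> = (\<Sum>i\<in>UNIV. \<Sum>k\<in>UNIV. \<Sum>j\<in>UNIV. X $ i $ j $ k * (u $ i * v $ j * w $ k))"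
    by (rule sum.swap)
  also have "\<dots> = (\<Sum>i\<in>UNIV. \<Sum>j\<in>UNIV. \<Sum>k\<in>UNIV. X $ i $ j $ k * (u $ i * v $ j * w $ k))"
    by (intro sum.cong refl sum.swap)
  finally show ?thesis by (simp add: inner_tensor3 rank_one_def)
qed

lemma induced_form_axis: "induced_form X (axis i 1) (axis j 1) = X $ i $ j"
proof (rule vec_eq_iff[THEN iffD2], intro allI)
  fix k
  have "induced_form X (axis i 1) (axis j 1) $ k =
      (\<Sum>i'\<in>UNIV. if i' = i then \<Sum>j'\<in>UNIV. if j' = j then X $ i' $ j' $ k else 0 else 0)"
    unfolding induced_form_def vec_lambda_beta
    by (intro sum.cong refl) (simp add: axis_def if_distrib[of "\<lambda>x. x * _"] cong: if_cong)
  then show "induced_form X (axis i 1) (axis j 1) $ k = X $ i $ j $ k"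
    by simp
qed

lemma power2_norm_tensor3: "(norm X)\<^sup>2 = (\<Sum>i\<in>UNIV. \<Sum>j\<in>UNIV. (norm (X $ i $ j))\<^sup>2)"
  for X :: "('l::finite, 'm::finite, 'n::finite) tensor3"
  by (simp add: power2_norm_eq_inner inner_vec_def)

lemma orthogonal_tensor3_iff_hurwitz_solution:
  "orthogonal_tensor3 X \<longleftrightarrow> hurwitz_solution (induced_form X)"
proof -
  interpret bilinear_form: bounded_bilinear "induced_form X"
    using bilinear_induced_form bilinear_conv_bounded_bilinear by blast
  have homogeneous: "norm (induced_form X u v) = norm u * norm v"
    if "\<forall>u v. norm u = 1 \<longrightarrow> norm v = 1 \<longrightarrow> norm (induced_form X u v) = 1" for u v
  proof (cases "u = 0 \<or> v = 0")
    case True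
    then show ?thesis by (auto simp: bilinear_form.zero_left bilinear_form.zero_right)
  next
    case False
    then have "norm (induced_form X (sgn u) (sgn v)) = 1"
      using that by (simp add: norm_sgn)
    moreover have "norm (induced_form X (sgn u) (sgn v)) =
        norm (induced_form X u v) / (norm u * norm v)"
      by (simp add: sgn_div_norm bilinear_form.scaleR_left bilinear_form.scaleR_right divide_inverse)
    ultimately show ?thesis by simp
  qed
  have "(\<forall>u v. norm u = 1 \<longrightarrow> norm v = 1 \<longrightarrow> norm (induced_form X u v) = 1) \<longleftrightarrow>
      (\<forall>u v. norm (induced_form X u v) = norm u * norm v)"
    (is "?unit \<longleftrightarrow> ?mult")
  proof
    show ?mult if ?unit
      using homogeneous[OF that] by blast
    show ?unit if ?mult
      using that by simp
  qed
  then show ?thesis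
    unfolding orthogonal_tensor3_def orthogonal_tensor2_def orthogonal_tensor1_def
      contract_first_twice hurwitz_solution_iff_norm
    using bilinear_induced_form by blast
qed

section \<open>Comparison of the spectral and the Frobenius norm\<close>

lemma spectral_norm_nonneg: "0 \<le> spectral_norm X"
  using spectral_norm_attained[of X] by auto

text \<open>Pairing \<open>\<omega>(u, v)\<close> with the unit vector in its own direction recovers its norm, so the
  supremum over unit \<open>w\<close> of \<open>\<bar>\<langle>\<omega>(u, v), w\<rangle>\<bar>\<close> is \<open>\<parallel>\<omega>(u, v)\<parallel>\<close>.\<close>

lemma norm_induced_form_le: "norm (induced_form X u v) \<le> spectral_norm X * norm u * norm v"
proof (cases "induced_form X u v = 0")
  case True
  then show ?thesis by (simp add: spectral_norm_nonneg)
next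
  case False
  interpret bilinear_form: bounded_bilinear "induced_form X"
    using bilinear_induced_form bilinear_conv_bounded_bilinear by blast
  let ?w = "induced_form X u v"
  from False have nz: "u \<noteq> 0" "v \<noteq> 0"
    by (auto simp: bilinear_form.zero_left bilinear_form.zero_right)
  have "X \<bullet> rank_one (sgn u) (sgn v) (sgn ?w) \<le> spectral_norm X"
    using nz False by (intro spectral_norm_upper[THEN abs_le_D1]) (simp_all add: norm_sgn)
  moreover have "X \<bullet> rank_one (sgn u) (sgn v) (sgn ?w) = norm ?w / (norm u * norm v)"
  proof -
    have "?w \<bullet> sgn ?w = norm ?w"
      using False by (simp add: sgn_div_norm dot_square_norm power2_eq_square)
    then show ?thesis
      unfolding inner_rank_one sgn_div_norm[of u] sgn_div_norm[of v]
      by (simp add: bilinear_form.scaleR_left bilinear_form.scaleR_right divide_inverse)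
  qed
  ultimately have "norm ?w / (norm u * norm v) \<le> spectral_norm X"
    by (simp only:)
  then show ?thesis using nz by (simp add: pos_divide_le_eq mult.assoc)
qed

lemma norm_fibre_le_spectral_norm: "norm (X $ i $ j) \<le> spectral_norm X"
  using norm_induced_form_le[of X "axis i 1" "axis j 1"] by (simp add: induced_form_axis)

lemma norm_le_spectral_norm:
  fixes X :: "('l::finite, 'm::finite, 'n::finite) tensor3"
  shows "norm X \<le> sqrt (real CARD('l) * real CARD('m)) * spectral_norm X"
proof -
  have "(norm X)\<^sup>2 \<le> (\<Sum>i\<in>(UNIV::'l set). \<Sum>j\<in>(UNIV::'m set). (spectral_norm X)\<^sup>2)"
    unfolding power2_norm_tensor3
    by (intro sum_mono power_mono norm_fibre_le_spectral_norm norm_ge_zero)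
  also have "\<dots> = (sqrt (real CARD('l) * real CARD('m)) * spectral_norm X)\<^sup>2"
    by (simp add: power_mult_distrib)
  finally show ?thesis
    by (rule power2_le_imp_le) (simp add: spectral_norm_nonneg)
qed

text \<open>Equality in the previous bound forces equality for every pair of basis vectors; the extremal
  principle for linear maps then spreads it to all vectors, one argument at a time.\<close>

lemma norm_induced_form_eq_if_extremal:
  fixes X :: "('l::finite, 'm::finite, 'n::finite) tensor3"
  assumes "norm X = sqrt (real CARD('l) * real CARD('m)) * spectral_norm X"
  shows "norm (induced_form X u v) = spectral_norm X * norm u * norm v"
proof -
  let ?s = "spectral_norm X"
  let ?P = "(UNIV :: 'l set) \<times> (UNIV :: 'm set)"
  have lin: "linear (induced_form X u)" "linear (\<lambda>u. induced_form X u v)" for u v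
    using bilinear_induced_form[of X] by (auto simp: bilinear_def)
  have "(\<Sum>(i,j)\<in>?P. ?s\<^sup>2 - (norm (X $ i $ j))\<^sup>2) = real CARD('l) * real CARD('m) * ?s\<^sup>2 - (norm X)\<^sup>2"
    unfolding sum.cartesian_product[symmetric]
    by (simp add: sum_subtractf power2_norm_tensor3)
  also have "\<dots> = 0"
    by (subst assms) (simp add: power_mult_distrib)
  finally have sum_0: "(\<Sum>(i,j)\<in>?P. ?s\<^sup>2 - (norm (X $ i $ j))\<^sup>2) = 0" .
  have fibre: "norm (X $ i $ j) = ?s" for i j
  proof -
    have "(case p of (i, j) \<Rightarrow> ?s\<^sup>2 - (norm (X $ i $ j))\<^sup>2) \<ge> 0" for p
      by (cases p) (simp add: power_mono norm_fibre_le_spectral_norm)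
    from sum_nonneg_0[OF _ this sum_0, of "(i, j)"] have "?s\<^sup>2 = (norm (X $ i $ j))\<^sup>2"
      by simp
    then show ?thesis by (simp add: power2_eq_iff_nonneg spectral_norm_nonneg)
  qed
  have axis_left: "norm (induced_form X (axis i 1) v) = ?s * norm v" for i v
  proof (rule norm_linear_eq_if_extremal_on_Basis[OF lin(1)])
    show "norm (induced_form X (axis i 1) v) \<le> ?s * norm v" for v
      using norm_induced_form_le[of X "axis i 1" v] by simp
    show "norm (induced_form X (axis i 1) b) = ?s" if "b \<in> Basis" for b
      using that by (auto simp: Basis_vec_def induced_form_axis fibre)
  qed
  have "norm (induced_form X u v) = (?s * norm v) * norm u"
  proof (rule norm_linear_eq_if_extremal_on_Basis[OF lin(2)])
    show "norm (induced_form X u v) \<le> ?s * norm v * norm u" for u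
      using norm_induced_form_le[of X u v] by (simp add: mult_ac)
    show "norm (induced_form X b v) = ?s * norm v" if "b \<in> Basis" for b
      using that by (auto simp: Basis_vec_def axis_left)
  qed
  then show ?thesis by (simp add: mult_ac)
qed

section \<open>The best approximation ratio and admissible triples\<close>

lemma App3_le:
  fixes X :: "('l::finite, 'm::finite, 'n::finite) tensor3"
  assumes "X \<noteq> 0"
  shows "App3 TYPE('l) TYPE('m) TYPE('n) \<le> spectral_norm X / norm X"
proof -
  obtain Y :: "('l, 'm, 'n) tensor3"
    where "App3 TYPE('l) TYPE('m) TYPE('n) = spectral_norm Y / norm Y"
      and "\<And>Z :: ('l, 'm, 'n) tensor3. Z \<noteq> 0 \<Longrightarrow>
        spectral_norm Y / norm Y \<le> spectral_norm Z / norm Z"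
    using App3_attained by blast
  then show ?thesis using assms by simp
qed

lemma inverse_sqrt_le_ratio:
  fixes X :: "('l::finite, 'm::finite, 'n::finite) tensor3"
  assumes "X \<noteq> 0"
  shows "1 / sqrt (real CARD('l) * real CARD('m)) \<le> spectral_norm X / norm X"
proof -
  define c where "c = sqrt (real CARD('l) * real CARD('m))"
  have "c > 0" by (simp add: c_def)
  moreover have "norm X \<le> c * spectral_norm X"
    unfolding c_def by (rule norm_le_spectral_norm)
  ultimately have "1 / c \<le> spectral_norm X / norm X"
    using assms by (simp add: divide_simps mult.commute)
  then show ?thesis by (simp only: c_def)
qed

lemma sum_scaleR_axis: "(\<Sum>i\<in>UNIV. (x $ i) *\<^sub>R axis i 1) = x" for x :: "real ^ 'n::finite"
  using basis_expansion[of x] by (simp only: scalar_mult_eq_scaleR)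

lemma induced_form_of_bilinear:
  assumes "bilinear \<omega>"
  shows "induced_form (\<chi> i j. \<omega> (axis i 1) (axis j 1)) = \<omega>"
proof (intro ext)
  fix u v
  interpret bounded_bilinear \<omega>
    using assms bilinear_conv_bounded_bilinear by blast
  have "\<omega> u v = \<omega> (\<Sum>i\<in>UNIV. (u $ i) *\<^sub>R axis i 1) (\<Sum>j\<in>UNIV. (v $ j) *\<^sub>R axis j 1)"
    by (simp only: sum_scaleR_axis)
  also have "\<dots> = (\<Sum>i\<in>UNIV. \<Sum>j\<in>UNIV. (u $ i * v $ j) *\<^sub>R \<omega> (axis i 1) (axis j 1))"
    by (subst sum.swap)
      (simp add: sum_left sum_right scaleR_left scaleR_right scaleR_sum_right mult_ac)
  finally show "induced_form (\<chi> i j. \<omega> (axis i 1) (axis j 1)) u v = \<omega> u v"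
    by (simp add: induced_form_def vec_eq_iff)
qed

text \<open>The tensor whose fibres are the values of the solution on pairs of basis vectors attains
  the bound.\<close>

lemma App3_le_if_admissible:
  assumes "hurwitz_admissible TYPE('l::finite) TYPE('m::finite) TYPE('n::finite)"
  shows "App3 TYPE('l) TYPE('m) TYPE('n) \<le> 1 / sqrt (real CARD('l) * real CARD('m))"
proof -
  obtain \<omega> :: "real ^ 'l \<Rightarrow> real ^ 'm \<Rightarrow> real ^ 'n"
    where bil: "bilinear \<omega>" and norm_mult: "\<And>u v. norm (\<omega> u v) = norm u * norm v"
    using assms by (auto simp: hurwitz_admissible_def hurwitz_solution_iff_norm)
  define X :: "('l, 'm, 'n) tensor3" where "X = (\<chi> i j. \<omega> (axis i 1) (axis j 1))"
  have form: "induced_form X = \<omega>"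
    using induced_form_of_bilinear[OF bil] by (simp add: X_def)
  obtain u v w where unit: "norm u = 1" "norm v = 1" "norm w = 1"
    and attained: "spectral_norm X = \<bar>X \<bullet> rank_one u v w\<bar>"
    using spectral_norm_attained by blast
  have "spectral_norm X \<le> 1"
    using Cauchy_Schwarz_ineq2[of "\<omega> u v" w]
    by (simp add: attained inner_rank_one form norm_mult unit)
  moreover have norm_X: "norm X = sqrt (real CARD('l) * real CARD('m))"
  proof -
    have "(norm X)\<^sup>2 = real CARD('l) * real CARD('m)"
      by (simp add: power2_norm_tensor3 X_def norm_mult)
    then show ?thesis by (simp add: real_sqrt_unique)
  qed
  moreover from norm_X have "X \<noteq> 0" by auto
  ultimately show ?thesis
    using App3_le[of X] divide_right_mono[of "spectral_norm X" 1 "norm X"] by simp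
qed

lemma admissible_if_extremal:
  fixes X :: "('l::finite, 'm::finite, 'n::finite) tensor3"
  assumes "X \<noteq> 0"
    and "spectral_norm X / norm X = 1 / sqrt (real CARD('l) * real CARD('m))"
  shows "hurwitz_admissible TYPE('l) TYPE('m) TYPE('n)"
proof -
  let ?s = "spectral_norm X"
  define c where "c = sqrt (real CARD('l) * real CARD('m))"
  have "c > 0" by (simp add: c_def)
  moreover have "?s / norm X = 1 / c"
    using assms(2) by (simp only: c_def)
  ultimately have norm_X: "norm X = sqrt (real CARD('l) * real CARD('m)) * ?s"
    unfolding c_def[symmetric] using assms(1)
      frac_eq_eq[of "norm X" c ?s 1] by (simp add: mult.commute)
  then have s: "?s \<noteq> 0" using assms(1) by auto
  have "?s > 0"
    using s spectral_norm_nonneg[of X] by simp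
  then have "norm (induced_form X u v /\<^sub>R ?s) = norm u * norm v" for u v
    using norm_induced_form_eq_if_extremal[OF norm_X, of u v] by simp
  moreover have "bilinear (\<lambda>u v. induced_form X u v /\<^sub>R ?s)"
    using bilinear_induced_form[of X] by (auto simp: bilinear_def intro: linear_compose_scale_right)
  ultimately show ?thesis
    unfolding hurwitz_admissible_def hurwitz_solution_iff_norm by blast
qed

theorem theorem4p1:
  assumes "CARD('l::finite) \<le> CARD('m::finite)" and "CARD('m) \<le> CARD('n::finite)"
  shows "(\<forall>X :: ('l, 'm, 'n) tensor3.
            orthogonal_tensor3 X \<longleftrightarrow> hurwitz_solution (induced_form X)) \<and>
         (App3 TYPE('l) TYPE('m) TYPE('n) = 1 / sqrt (real CARD('l) * real CARD('m)) \<longleftrightarrow>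
            hurwitz_admissible TYPE('l) TYPE('m) TYPE('n))"
proof -
  obtain X :: "('l, 'm, 'n) tensor3"
    where "X \<noteq> 0" and min: "App3 TYPE('l) TYPE('m) TYPE('n) = spectral_norm X / norm X"
    using App3_attained by blast
  from \<open>X \<noteq> 0\<close> have "1 / sqrt (real CARD('l) * real CARD('m)) \<le> App3 TYPE('l) TYPE('m) TYPE('n)"
    unfolding min by (rule inverse_sqrt_le_ratio)
  then have "App3 TYPE('l) TYPE('m) TYPE('n) = 1 / sqrt (real CARD('l) * real CARD('m)) \<longleftrightarrow>
      hurwitz_admissible TYPE('l) TYPE('m) TYPE('n)"
    using admissible_if_extremal[OF \<open>X \<noteq> 0\<close>, folded min] App3_le_if_admissible order_antisym
    by blast
  then show ?thesis
    using orthogonal_tensor3_iff_hurwitz_solution by blast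
qed

end
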